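(* Let $(Q,\cdot,\backslash)$ be a left division left cancelation groupoid which satisfies the Tarki associative law $x\cdot(z\cdot y)=(x\cdot y)\cdot z$ for all $x,y,z\in Q$. Then $(Q,\cdot)$ is a commutative group, and it satisfies each of the following identities for all $x,y,z\in Q$: $x\cdot(y\cdot z)=(x\cdot y)\cdot z$; $x\cdot(y\cdot z)=z\cdot(y\cdot x)$; $x\cdot(y\cdot z)=y\cdot(x\cdot z)$; $x\cdot(y\cdot z)=(z\cdot x)\cdot y$.
   Context: A groupoid $(Q,\cdot)$ is a non-empty set $Q$ with a binary operation $\cdot$. For $a\in Q$ let $L_a:Q\to Q$, $L_a x=a\cdot x$. The groupoid is a left division groupoid if $L_a$ is surjective for every $a\in Q$, and a left cancelation groupoid if $L_a$ is injective for every $a\in Q$. Writing a left division left cancelation groupoid as $(Q,\cdot,\backslash)$ means that $\backslash$ is the binary operation on $Q$ satisfying $x\cdot(x\backslash y)=y$ and $x\backslash(x\cdot y)=y$ for all $x,y\in Q$. *)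

theory Defs
  imports "HOL-Algebra.Group"
begin

locale groupoid =
  fixes Q :: "'a set" and mul :: "'a \<Rightarrow> 'a \<Rightarrow> 'a"
  assumes nonempty: "Q \<noteq> {}"
    and closed: "\<lbrakk>x \<in> Q; y \<in> Q\<rbrakk> \<Longrightarrow> mul x y \<in> Q"

definition left_translation :: "('a \<Rightarrow> 'a \<Rightarrow> 'a) \<Rightarrow> 'a \<Rightarrow> 'a \<Rightarrow> 'a"
  where "left_translation mul a = (\<lambda>x. mul a x)"

locale left_division_groupoid = groupoid +
  assumes left_translation_surj: "a \<in> Q \<Longrightarrow> left_translation mul a ` Q = Q"

locale left_cancelation_groupoid = groupoid +
  assumes left_translation_inj: "a \<in> Q \<Longrightarrow> inj_on (left_translation mul a) Q"

locale left_division_left_cancelation_groupoid =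
  left_division_groupoid Q mul + left_cancelation_groupoid Q mul
  for Q :: "'a set" and mul :: "'a \<Rightarrow> 'a \<Rightarrow> 'a" +
  fixes ldiv :: "'a \<Rightarrow> 'a \<Rightarrow> 'a"
  assumes ldiv_closed: "\<lbrakk>x \<in> Q; y \<in> Q\<rbrakk> \<Longrightarrow> ldiv x y \<in> Q"
    and mul_ldiv: "\<lbrakk>x \<in> Q; y \<in> Q\<rbrakk> \<Longrightarrow> mul x (ldiv x y) = y"
    and ldiv_mul: "\<lbrakk>x \<in> Q; y \<in> Q\<rbrakk> \<Longrightarrow> ldiv x (mul x y) = y"

text \<open>A set with a binary operation carries no distinguished unit, whereas the record type of
  \<^locale>\<open>comm_group\<close> does; hence the unit is existentially quantified.\<close>

definition is_comm_group :: "'a set \<Rightarrow> ('a \<Rightarrow> 'a \<Rightarrow> 'a) \<Rightarrow> bool"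
  where "is_comm_group Q mul \<longleftrightarrow>
    (\<exists>e. comm_group \<lparr>carrier = Q, monoid.mult = mul, one = e\<rparr>)"

end

theory Submission
  imports Defs
begin

text \<open>The Tarski law is associativity with two inner factors exchanged, so commutativity is
  all that is missing. Division and cancelation yield a two-sided unit (\<open>ex_unit\<close>);
  with the unit as outer left factor the law becomes \<open>commute\<close>, which turns the law
  into \<open>assoc\<close>. Division then supplies inverses.\<close>

locale tarski_groupoid = left_division_left_cancelation_groupoid +
  assumes tarski: "\<lbrakk>x \<in> Q; y \<in> Q; z \<in> Q\<rbrakk> \<Longrightarrow> mul x (mul z y) = mul (mul x y) z"
begin

lemma left_cancel:
  assumes "a \<in> Q" "x \<in> Q" "y \<in> Q" "mul a x = mul a y"
  shows "x = y"
  using assms by (metis ldiv_mul)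

text \<open>A local right unit \<open>e\<close> at \<open>a\<close> is global: \<open>a \<cdot> z = (a \<cdot> e) \<cdot> z = a \<cdot> (z \<cdot> e)\<close>, and \<open>a\<close> cancels.\<close>

lemma ex_unit:
  obtains e where "e \<in> Q" "\<And>z. z \<in> Q \<Longrightarrow> mul z e = z" "\<And>z. z \<in> Q \<Longrightarrow> mul e z = z"
proof -
  obtain a where a: "a \<in> Q"
    using nonempty by blast
  define e where "e = ldiv a a"
  have e: "e \<in> Q" "mul a e = a"
    using a by (simp_all add: e_def ldiv_closed mul_ldiv)
  have right: "mul z e = z" if "z \<in> Q" for z
  proof (rule left_cancel[OF a])
    show "mul a (mul z e) = mul a z"
      using tarski[OF a \<open>e \<in> Q\<close> that] e by simp
  qed (use e that closed in auto)
  have left: "mul e z = z" if "z \<in> Q" for z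
  proof (rule left_cancel[OF a])
    show "mul a (mul e z) = mul a z"
      \<comment> \<open>Here a (e z) = (a z) e, and \<open>e\<close> is already a right unit for a
        z.\<close>
      using tarski[OF a that \<open>e \<in> Q\<close>] right closed a that by simp
  qed (use e that closed in auto)
  show thesis
    using that e(1) right left by blast
qed

text \<open>With the left unit in front, the Tarski law e (x y) = (e y) x collapses to x y = y
  x.\<close>

lemma commute:
  assumes "x \<in> Q" "y \<in> Q"
  shows "mul x y = mul y x"
proof -
  obtain e where e: "e \<in> Q" "\<And>z. z \<in> Q \<Longrightarrow> mul e z = z"
    using ex_unit by metis
  show ?thesis
    using tarski[OF e(1) assms(2,1)] e closed assms by simp
qed

lemma assoc:
  assumes "x \<in> Q" "y \<in> Q" "z \<in> Q"
  shows "mul x (mul y z) = mul (mul x y) z"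
  using tarski[OF assms] commute[OF assms(2,3)] by simp

lemma is_comm_group: "is_comm_group Q mul"
proof -
  obtain e where e: "e \<in> Q" "\<And>z. z \<in> Q \<Longrightarrow> mul e z = z"
    using ex_unit by metis
  have "comm_group \<lparr>carrier = Q, monoid.mult = mul, one = e\<rparr>"
  proof (rule comm_groupI, simp_all add: e closed assoc)
    show "mul x y = mul y x" if "x \<in> Q" "y \<in> Q" for x y
      using commute that by blast
    \<comment> \<open>The witness is \<open>ldiv x e\<close>, a right inverse by division and hence
      a left inverse by commutativity.\<close>
    show "\<exists>y\<in>Q. mul y x = e" if "x \<in> Q" for x
      using commute mul_ldiv ldiv_closed that e(1) by metis
  qed
  then show ?thesis
    unfolding is_comm_group_def by blast
qed

end

theorem theorem6:
  fixes Q :: "'a set"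
    and mul :: "'a \<Rightarrow> 'a \<Rightarrow> 'a"  (infixl "\<cdot>" 70)
    and ldiv :: "'a \<Rightarrow> 'a \<Rightarrow> 'a"
  assumes "left_division_left_cancelation_groupoid Q mul ldiv"
    and "\<forall>x\<in>Q. \<forall>y\<in>Q. \<forall>z\<in>Q. x \<cdot> (z \<cdot> y) = (x \<cdot> y) \<cdot> z"
  shows "is_comm_group Q mul
    \<and> (\<forall>x\<in>Q. \<forall>y\<in>Q. \<forall>z\<in>Q. x \<cdot> (y \<cdot> z) = (x \<cdot> y) \<cdot> z)
    \<and> (\<forall>x\<in>Q. \<forall>y\<in>Q. \<forall>z\<in>Q. x \<cdot> (y \<cdot> z) = z \<cdot> (y \<cdot> x))
    \<and> (\<forall>x\<in>Q. \<forall>y\<in>Q. \<forall>z\<in>Q. x \<cdot> (y \<cdot> z) = y \<cdot> (x \<cdot> z))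
    \<and> (\<forall>x\<in>Q. \<forall>y\<in>Q. \<forall>z\<in>Q. x \<cdot> (y \<cdot> z) = (z \<cdot> x) \<cdot> y)"
proof -
  interpret tarski_groupoid Q mul ldiv
    using assms by (simp add: tarski_groupoid_def tarski_groupoid_axioms_def)
  \<comment> \<open>Both sides multiply the same three elements, so order and bracketing are
    immaterial.\<close>
  have "x \<cdot> (y \<cdot> z) = z \<cdot> (y \<cdot> x)" "x \<cdot> (y \<cdot> z) = y \<cdot> (x \<cdot> z)" "x \<cdot> (y \<cdot> z) = (z \<cdot> x) \<cdot> y"
    if "x \<in> Q" "y \<in> Q" "z \<in> Q" for x y z
    using that by (metis assoc commute closed)+
  then show ?thesis
    using is_comm_group assoc by blast
qed

end
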